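(* Let $d\geq 2$, let $\xi\in\mathbb{C}$ with $\xi^2=-1$, let $P(x,y)=\sum_{2\le i+j\le d}p_{i,j}x^iy^j$ with $p_{i,j}\in\mathbb{C}$, and let $$X=\xi(x\partial_x-y\partial_y)+P(x,y)\partial_x+\Big(\sum_{2\le i+j\le d}\overline{p_{j,i}}\,x^iy^j\Big)\partial_y .$$ Assume that $$p_{i,n-i}=0\quad\text{for all } n=2,\dots,d \text{ and } i=0,\dots,n-1 .$$ Then the resonant subset $\mathfrak{b}_{res}$ of the Lie algebra $\mathfrak{b}$ generated by the homogeneous differential operators $\{B_n\}_{n\in A(X)}$ of $X$ is trivial, i.e. $\mathfrak{b}_{res}=\{0\}$.
   Context: $X$ is the complex representation on $\mathbb{C}^2$ of a real planar polynomial vector field (with $y=\bar x$ on the real plane); for algebraic computations $x,y$ are treated as independent variables, and $\partial_x=\partial/\partial x$, $\partial_y=\partial/\partial y$. The vector field is decomposed as $X=\xi(x\partial_x-y\partial_y)+\sum_{n\in A(X)}B_n$, where $B_n$ is a homogeneous differential operator of degree $n=(n_1,n_2)\in\mathbb{Z}^2$, i.e. it maps each monomial $x^{m_1}y^{m_2}$ to a constant multiple of $x^{m_1+n_1}y^{m_2+n_2}$, and $A(X)$ is the set of degrees which occur. The operators are, for $2\le k\le d$ and $1\le i\le k$, $$B_{(i-1,k-i)}=x^{i-1}y^{k-i}\big(p_{i,k-i}\,x\partial_x+\overline{p_{k-i+1,i-1}}\,y\partial_y\big),\quad B_{(-1,k)}=p_{0,k}\,y^k\partial_x,\quad B_{(k,-1)}=\overline{p_{0,k}}\,x^k\partial_y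 .$$ $A^*(X)$ denotes the set of words $\mathbf{n}=n_1\cdot n_2\cdots n_r$ with letters $n_j\in A(X)$. The weight of a letter $n=(a,b)$ is $\omega(n)=\langle n,(\xi,-\xi)\rangle=\xi(a-b)$, and the weight of a word $\mathbf{n}=n_1\cdots n_r$ is $\omega(\mathbf{n})=\sum_{j=1}^r\omega(n_j)$. For a nonempty word, $[B_{\mathbf{n}}]=B_{n_1}$ if $r=1$ and $[B_{\mathbf{n}}]=[B_{n_r},[B_{n_{r-1}},\dots,[B_{n_2},B_{n_1}]\dots]]$ if $r\ge2$, where $[\cdot,\cdot]$ is the usual commutator of vector fields. The resonant subset $\mathfrak{b}_{res}\subset\mathfrak{b}$ is the subset generated by all $[B_{\mathbf{n}}]$ with $\mathbf{n}\in A^*(X)$ a nonempty word such that $\omega(\mathbf{n})=0$; thus $\mathfrak{b}_{res}=\{0\}$ means that $[B_{\mathbf{n}}]=0$ for every nonempty word $\mathbf{n}\in A^*(X)$ with $\omega(\mathbf{n})=0$. *)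

theory Defs
  imports
    Complex_Main
    "HOL-Computational_Algebra.Polynomial"
    "HOL-Library.Function_Algebras"
begin

text \<open>
  The ring \<open>\<complex>[x, y]\<close> is \<^typ>\<open>complex poly poly\<close>: the inner indeterminate is \<open>x\<close>, the outer
  one is \<open>y\<close>. Vector fields and differential operators are maps on this ring; their sums and
  their zero are the pointwise ones.
\<close>

type_synonym diff_op = "complex poly poly \<Rightarrow> complex poly poly"

definition cst :: "complex \<Rightarrow> complex poly poly"
  where "cst c = [:[:c:]:]"

definition vx :: "complex poly poly"
  where "vx = [:[:0, 1:]:]"

definition vy :: "complex poly poly"
  where "vy = [:0, 1:]"

definition dx :: diff_op
  where "dx f = map_poly pderiv f"

definition dy :: diff_op
  where "dy f = pderiv f"

definition op_scale :: "complex \<Rightarrow> diff_op \<Rightarrow> diff_op"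
  where "op_scale c T = (\<lambda>f. cst c * T f)"

definition commutator :: "diff_op \<Rightarrow> diff_op \<Rightarrow> diff_op"
  where "commutator S T = (\<lambda>f. S (T f) - T (S f))"

inductive_set lie_generated :: "diff_op set \<Rightarrow> diff_op set" for S :: "diff_op set"
  where
    base: "T \<in> S \<Longrightarrow> T \<in> lie_generated S"
  | zero: "0 \<in> lie_generated S"
  | add: "T \<in> lie_generated S \<Longrightarrow> U \<in> lie_generated S \<Longrightarrow> T + U \<in> lie_generated S"
  | scale: "T \<in> lie_generated S \<Longrightarrow> op_scale c T \<in> lie_generated S"
  | bracket: "T \<in> lie_generated S \<Longrightarrow> U \<in> lie_generated S \<Longrightarrow> commutator T U \<in> lie_generated S"


text \<open>
  The vector field \<open>X\<close> with coefficients \<open>p i j\<close>. Only the \<open>p i j\<close> with \<open>2 \<le> i + j \<le> d\<close> matter.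
\<close>

definition linear_part :: "complex \<Rightarrow> diff_op"
  where "linear_part \<xi> = (\<lambda>f. cst \<xi> * (vx * dx f - vy * dy f))"

definition index_set :: "nat \<Rightarrow> (nat \<times> nat) set"
  where "index_set d = {(i, j). 2 \<le> i + j \<and> i + j \<le> d}"

definition vector_field :: "complex \<Rightarrow> nat \<Rightarrow> (nat \<Rightarrow> nat \<Rightarrow> complex) \<Rightarrow> diff_op"
  where "vector_field \<xi> d p = (\<lambda>f. linear_part \<xi> f
    + (\<Sum>(i, j)\<in>index_set d. cst (p i j) * vx ^ i * vy ^ j) * dx f
    + (\<Sum>(i, j)\<in>index_set d. cst (cnj (p j i)) * vx ^ i * vy ^ j) * dy f)"

text \<open>
  The operator \<open>B\<^sub>n\<close> as a function of its degree \<open>n = (a, b)\<close>. In the first case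
  \<open>(a, b) = (i - 1, k - i)\<close>, that is, \<open>i = a + 1\<close> and \<open>k = a + b + 1\<close>, with \<open>2 \<le> k \<le> d\<close>.
\<close>

definition hom_op :: "nat \<Rightarrow> (nat \<Rightarrow> nat \<Rightarrow> complex) \<Rightarrow> int \<times> int \<Rightarrow> diff_op"
  where "hom_op d p = (\<lambda>(a, b).
    if 0 \<le> a \<and> 0 \<le> b \<and> 2 \<le> a + b + 1 \<and> a + b + 1 \<le> int d then
      (\<lambda>f. vx ^ nat a * vy ^ nat b *
        (cst (p (nat a + 1) (nat b)) * vx * dx f + cst (cnj (p (nat b + 1) (nat a))) * vy * dy f))
    else if a = -1 \<and> 2 \<le> b \<and> b \<le> int d then
      (\<lambda>f. cst (p 0 (nat b)) * vy ^ nat b * dx f)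
    else if b = -1 \<and> 2 \<le> a \<and> a \<le> int d then
      (\<lambda>f. cst (cnj (p 0 (nat a))) * vx ^ nat a * dy f)
    else 0)"

definition degrees :: "nat \<Rightarrow> (nat \<Rightarrow> nat \<Rightarrow> complex) \<Rightarrow> (int \<times> int) set"
  where "degrees d p = {n. hom_op d p n \<noteq> 0}"

definition letter_weight :: "complex \<Rightarrow> int \<times> int \<Rightarrow> complex"
  where "letter_weight \<xi> = (\<lambda>(a, b). \<xi> * of_int (a - b))"

definition word_weight :: "complex \<Rightarrow> (int \<times> int) list \<Rightarrow> complex"
  where "word_weight \<xi> w = sum_list (map (letter_weight \<xi>) w)"

text \<open>
  \<open>[B n\<^sub>r, [B n\<^sub>r\<^sub>-\<^sub>1, \<dots>, [B n\<^sub>2, B n\<^sub>1] \<dots>]]\<close>: the first letter is the innermost one. The value at the empty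
  word is immaterial.
\<close>

fun word_bracket :: "(int \<times> int \<Rightarrow> diff_op) \<Rightarrow> (int \<times> int) list \<Rightarrow> diff_op"
  where
    "word_bracket B [] = 0"
  | "word_bracket B (n # w) = foldl (\<lambda>T m. commutator (B m) T) (B n) w"

definition lie_algebra_b :: "nat \<Rightarrow> (nat \<Rightarrow> nat \<Rightarrow> complex) \<Rightarrow> diff_op set"
  where "lie_algebra_b d p = lie_generated (hom_op d p ` degrees d p)"

definition resonant_subset :: "complex \<Rightarrow> nat \<Rightarrow> (nat \<Rightarrow> nat \<Rightarrow> complex) \<Rightarrow> diff_op set"
  where "resonant_subset \<xi> d p = lie_generated
    {word_bracket (hom_op d p) w | w.
      w \<in> lists (degrees d p) \<and> w \<noteq> [] \<and> word_weight \<xi> w = 0}"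


text \<open>Checks: the operators \<open>B\<^sub>n\<close> are the homogeneous components of \<open>X\<close>, and \<open>\<bb>\<^sub>r\<^sub>e\<^sub>s\<close> lies in \<open>\<bb>\<close>.\<close>

definition homogeneous :: "int \<times> int \<Rightarrow> diff_op \<Rightarrow> bool"
  where "homogeneous = (\<lambda>(a, b) T. \<forall>i j. \<exists>c.
    if 0 \<le> int i + a \<and> 0 \<le> int j + b
    then T (vx ^ i * vy ^ j) = cst c * vx ^ nat (int i + a) * vy ^ nat (int j + b)
    else T (vx ^ i * vy ^ j) = 0)"

lemma vxy_monom: "cst c * vx ^ i * vy ^ j = monom (monom c i) j"
proof -
  have "vx ^ i = [:monom 1 i:]"
    by (induction i) (simp_all add: vx_def monom_Suc one_pCons)
  moreover have "vy ^ j = monom 1 j"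
    by (induction j) (simp_all add: vy_def monom_Suc)
  ultimately show ?thesis
    by (simp add: cst_def smult_monom)
qed

lemma vxy_monom1: "vx ^ i * vy ^ j = monom (monom 1 i) j"
  using vxy_monom[of 1 i j] by (simp add: cst_def flip: one_pCons)

lemma dx_monom: "dx (monom (monom c i) j) = monom (monom (of_nat i * c) (i - 1)) j"
  by (simp add: dx_def map_poly_monom pderiv_monom)

lemma dy_monom: "dy (monom (monom c i) j) = monom (monom (of_nat j * c) i) (j - 1)"
  by (simp add: dy_def pderiv_monom of_nat_monom mult_monom)

text \<open>Coefficients of \<open>\<partial>\<^sub>x\<close> and \<open>\<partial>\<^sub>y\<close> in \<open>B\<^sub>n\<close>.\<close>

definition coef_dx :: "nat \<Rightarrow> (nat \<Rightarrow> nat \<Rightarrow> complex) \<Rightarrow> int \<times> int \<Rightarrow> complex poly poly"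
  where "coef_dx d p = (\<lambda>(a, b). if -1 \<le> a \<and> 0 \<le> b \<and> 2 \<le> a + b + 1 \<and> a + b + 1 \<le> int d
    then monom (monom (p (nat (a + 1)) (nat b)) (nat (a + 1))) (nat b) else 0)"

definition coef_dy :: "nat \<Rightarrow> (nat \<Rightarrow> nat \<Rightarrow> complex) \<Rightarrow> int \<times> int \<Rightarrow> complex poly poly"
  where "coef_dy d p = (\<lambda>(a, b). if 0 \<le> a \<and> -1 \<le> b \<and> 2 \<le> a + b + 1 \<and> a + b + 1 \<le> int d
    then monom (monom (cnj (p (nat (b + 1)) (nat a))) (nat a)) (nat (b + 1)) else 0)"

lemma hom_op_eq: "hom_op d p n = (\<lambda>f. coef_dx d p n * dx f + coef_dy d p n * dy f)"
proof (cases n)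
  case (Pair a b)
  consider (1) "0 \<le> a \<and> 0 \<le> b \<and> 2 \<le> a + b + 1 \<and> a + b + 1 \<le> int d"
    | (2) "a = -1 \<and> 2 \<le> b \<and> b \<le> int d"
    | (3) "b = -1 \<and> 2 \<le> a \<and> a \<le> int d"
    | (4) "\<not> (0 \<le> a \<and> 0 \<le> b \<and> 2 \<le> a + b + 1 \<and> a + b + 1 \<le> int d)"
        "\<not> (a = -1 \<and> 2 \<le> b \<and> b \<le> int d)" "\<not> (b = -1 \<and> 2 \<le> a \<and> a \<le> int d)"
    by blast
  then show ?thesis
  proof cases
    case 1
    then have s: "nat (a + 1) = Suc (nat a)" "nat (b + 1) = Suc (nat b)" by auto
    have x: "coef_dx d p n = vx ^ nat a * vy ^ nat b * (cst (p (nat a + 1) (nat b)) * vx)"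
      using 1 by (simp add: Pair coef_dx_def s mult_ac flip: vxy_monom)
    have y: "coef_dy d p n = vx ^ nat a * vy ^ nat b * (cst (cnj (p (nat b + 1) (nat a))) * vy)"
      using 1 by (simp add: Pair coef_dy_def s mult_ac flip: vxy_monom)
    have "hom_op d p n = (\<lambda>f. vx ^ nat a * vy ^ nat b *
        (cst (p (nat a + 1) (nat b)) * vx * dx f + cst (cnj (p (nat b + 1) (nat a))) * vy * dy f))"
      using 1 by (simp add: Pair hom_op_def)
    then show ?thesis
      by (simp only: x y) (simp add: algebra_simps)
  next
    case 2
    then show ?thesis
      by (simp add: Pair hom_op_def coef_dx_def coef_dy_def flip: vxy_monom)
  next
    case 3
    then show ?thesis
      by (simp add: Pair hom_op_def coef_dx_def coef_dy_def flip: vxy_monom)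
  next
    case 4
    then show ?thesis
      by (auto simp: Pair hom_op_def coef_dx_def coef_dy_def fun_eq_iff)
  qed
qed

lemma homogeneous_hom_op: "homogeneous n (hom_op d p n)"
proof (cases n)
  case (Pair a b)
  have "\<exists>c. if 0 \<le> int i + a \<and> 0 \<le> int j + b
    then hom_op d p (a, b) (monom (monom 1 i) j)
      = monom (monom c (nat (int i + a))) (nat (int j + b))
    else hom_op d p (a, b) (monom (monom 1 i) j) = 0" for i j
  proof -
    define u where "u = (if -1 \<le> a \<and> 0 \<le> b \<and> 2 \<le> a + b + 1 \<and> a + b + 1 \<le> int d
      then p (nat (a + 1)) (nat b) * of_nat i else 0)"
    define v where "v = (if 0 \<le> a \<and> -1 \<le> b \<and> 2 \<le> a + b + 1 \<and> a + b + 1 \<le> int d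
      then cnj (p (nat (b + 1)) (nat a)) * of_nat j else 0)"
    have U: "coef_dx d p (a, b) * dx (monom (monom 1 i) j) =
      (if 0 \<le> int i + a \<and> 0 \<le> int j + b
       then monom (monom u (nat (int i + a))) (nat (int j + b)) else 0)"
    proof (cases "i = 0")
      case False
      then have "-1 \<le> a \<Longrightarrow> nat (a + 1) + (i - 1) = nat (int i + a)" by linarith
      moreover have "0 \<le> b \<Longrightarrow> nat b + j = nat (int j + b)" by linarith
      moreover have "-1 \<le> a \<Longrightarrow> 0 \<le> int i + a" using False by linarith
      ultimately show ?thesis
        by (auto simp: coef_dx_def dx_monom mult_monom u_def)
    qed (simp add: dx_def u_def map_poly_monom pderiv_monom)
    have V: "coef_dy d p (a, b) * dy (monom (monom 1 i) j) =
      (if 0 \<le> int i + a \<and> 0 \<le> int j + b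
       then monom (monom v (nat (int i + a))) (nat (int j + b)) else 0)"
    proof (cases "j = 0")
      case False
      then have "-1 \<le> b \<Longrightarrow> nat (b + 1) + (j - 1) = nat (int j + b)" by linarith
      moreover have "0 \<le> a \<Longrightarrow> nat a + i = nat (int i + a)" by linarith
      moreover have "-1 \<le> b \<Longrightarrow> 0 \<le> int j + b" using False by linarith
      ultimately show ?thesis
        by (auto simp: coef_dy_def dy_monom mult_monom v_def)
    qed (simp add: dy_def v_def pderiv_monom)
    show ?thesis
      by (rule exI[of _ "u + v"]) (auto simp: hom_op_eq U V add_monom)
  qed
  then show ?thesis
    unfolding homogeneous_def Pair vxy_monom vxy_monom1 prod.case by blast
qed

lemma sum_fun_apply: "(\<Sum>n\<in>A. F n) f = (\<Sum>n\<in>A. F n f)"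
  for F :: "'a \<Rightarrow> 'b \<Rightarrow> 'c::comm_monoid_add"
  by (induction A rule: infinite_finite_induct) auto

lemma
  shows finite_degrees: "finite (degrees d p)"
    and vector_field_decomposition:
      "vector_field \<xi> d p = linear_part \<xi> + (\<Sum>n\<in>degrees d p. hom_op d p n)"
proof -
  define S where "S = {-1..int d} \<times> {-1..int d}"
  have S: "finite S" by (simp add: S_def)
  have sub: "degrees d p \<subseteq> S"
    by (auto simp: degrees_def hom_op_def S_def split: if_splits)
  then show "finite (degrees d p)" using S finite_subset by blast
  have X: "(\<Sum>n\<in>S. coef_dx d p n) = (\<Sum>(i, j)\<in>index_set d. cst (p i j) * vx ^ i * vy ^ j)"
    (is "_ = ?RHS")
  proof -
    let ?S' = "{(a, b). (a, b) \<in> S \<and> 0 \<le> b \<and> 2 \<le> a + b + 1 \<and> a + b + 1 \<le> int d}"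
    have "(\<Sum>n\<in>S. coef_dx d p n) = (\<Sum>n\<in>?S'. coef_dx d p n)"
      by (rule sum.mono_neutral_right) (use S in \<open>auto simp: coef_dx_def split: if_splits\<close>)
    also have "\<dots> = ?RHS"
      unfolding vxy_monom
      by (rule sum.reindex_bij_witness
          [where j = "\<lambda>(a, b). (nat (a + 1), nat b)" and i = "\<lambda>(i, j). (int i - 1, int j)"])
        (auto simp: S_def coef_dx_def index_set_def)
    finally show ?thesis .
  qed
  have Y: "(\<Sum>n\<in>S. coef_dy d p n) = (\<Sum>(i, j)\<in>index_set d. cst (cnj (p j i)) * vx ^ i * vy ^ j)"
    (is "_ = ?RHS")
  proof -
    let ?S' = "{(a, b). (a, b) \<in> S \<and> 0 \<le> a \<and> 2 \<le> a + b + 1 \<and> a + b + 1 \<le> int d}"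
    have "(\<Sum>n\<in>S. coef_dy d p n) = (\<Sum>n\<in>?S'. coef_dy d p n)"
      by (rule sum.mono_neutral_right) (use S in \<open>auto simp: coef_dy_def split: if_splits\<close>)
    also have "\<dots> = ?RHS"
      unfolding vxy_monom
      by (rule sum.reindex_bij_witness
          [where j = "\<lambda>(a, b). (nat a, nat (b + 1))" and i = "\<lambda>(i, j). (int i, int j - 1)"])
        (auto simp: S_def coef_dy_def index_set_def)
    finally show ?thesis .
  qed
  have "(\<Sum>n\<in>degrees d p. hom_op d p n) = (\<Sum>n\<in>S. hom_op d p n)"
    by (rule sum.mono_neutral_left) (use S sub in \<open>auto simp: degrees_def\<close>)
  then show "vector_field \<xi> d p = linear_part \<xi> + (\<Sum>n\<in>degrees d p. hom_op d p n)"
    by (auto simp: fun_eq_iff vector_field_def sum_fun_apply hom_op_eq sum.distrib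
        simp flip: X Y sum_distrib_right)
qed

lemma resonant_subset_le: "resonant_subset \<xi> d p \<subseteq> lie_algebra_b d p"
proof -
  have word: "word_bracket (hom_op d p) w \<in> lie_algebra_b d p"
    if "w \<in> lists (degrees d p)" "w \<noteq> []" for w
  proof -
    have *: "foldl (\<lambda>T m. commutator (hom_op d p m) T) T v \<in> lie_algebra_b d p"
      if "v \<in> lists (degrees d p)" "T \<in> lie_algebra_b d p" for T v
      using that
      by (induction v arbitrary: T)
        (simp_all add: lie_algebra_b_def lie_generated.bracket lie_generated.base)
    show ?thesis
      using that * by (cases w) (auto simp: lie_algebra_b_def intro: lie_generated.base)
  qed
  show ?thesis
  proof
    fix T assume "T \<in> resonant_subset \<xi> d p"
    then show "T \<in> lie_algebra_b d p"
      unfolding resonant_subset_def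
    proof (induction rule: lie_generated.induct)
      case (base T)
      then show ?case using word by auto
    qed (unfold lie_algebra_b_def, (blast intro: lie_generated.intros)+)
  qed
qed

end

theory Submission
  imports Defs
begin

text \<open>
  The hypothesis leaves only the pure powers \<open>p\<^sub>n\<^sub>,\<^sub>0 x\<^sup>n\<close> in \<open>P\<close>, so \<open>X\<close> splits into a field in \<open>x\<close> alone
  and a field in \<open>y\<close> alone. Every letter is therefore either horizontal, of degree \<open>(a, 0)\<close> with
  \<open>a > 0\<close> and operator \<open>g(x) \<partial>\<^sub>x\<close>, or vertical, of degree \<open>(0, b)\<close> with \<open>b > 0\<close> and operator
  \<open>h(y) \<partial>\<^sub>y\<close> (lemmas \<open>degree_cases\<close>, \<open>hom_op_horizontal\<close>, \<open>hom_op_vertical\<close>).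

  Horizontal letters have weights in \<open>\<xi> \<cdot> \<nat>\<^sub>>\<^sub>0\<close> and vertical ones in \<open>-\<xi> \<cdot> \<nat>\<^sub>>\<^sub>0\<close>; a nonempty word of
  weight zero must contain both kinds. As long as the letters read are of one kind, the nested
  bracket is again a field of that kind (\<open>commutator_along\<close>); at the first letter of the other kind it
  vanishes, because \<open>g(x) \<partial>\<^sub>x\<close> and \<open>h(y) \<partial>\<^sub>y\<close> commute (\<open>commutator_transverse\<close>), and it stays zero
  afterwards (\<open>word_bracket_mixed\<close>). So all generators of \<open>\<bb>\<^sub>r\<^sub>e\<^sub>s\<close> are zero.
\<close>

section \<open>Fields along one of two commuting derivations\<close>

text \<open>
  The roles of \<open>x\<close> and \<open>y\<close> are symmetric, so the commutator computations are made once, for two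
  commuting derivations \<open>D\<close> and \<open>E\<close>, and used with \<open>(D, E)\<close> equal to \<open>(\<partial>\<^sub>x, \<partial>\<^sub>y)\<close> and to
  \<open>(\<partial>\<^sub>y, \<partial>\<^sub>x)\<close>.
\<close>

definition derivation :: "diff_op \<Rightarrow> bool"
  where "derivation D \<longleftrightarrow>
    (\<forall>f g. D (f + g) = D f + D g) \<and> (\<forall>f g. D (f * g) = D f * g + f * D g)"

lemma derivation_mult: "derivation D \<Longrightarrow> D (f * g) = D f * g + f * D g"
  by (simp add: derivation_def)

lemma derivation_zero: "derivation D \<Longrightarrow> D 0 = 0"
  unfolding derivation_def by (metis add_cancel_right_left)

lemma derivation_diff: "derivation D \<Longrightarrow> D (f - g) = D f - D g"
  unfolding derivation_def by (metis add_diff_cancel_right' diff_add_cancel)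

text \<open>
  For \<open>D = \<partial>\<^sub>x\<close> and \<open>E = \<partial>\<^sub>y\<close> these are the fields \<open>g(x) \<partial>\<^sub>x\<close>: the condition \<open>E g = 0\<close> says that the
  coefficient does not involve the other variable.
\<close>

definition fields_along :: "diff_op \<Rightarrow> diff_op \<Rightarrow> diff_op set"
  where "fields_along D E = {\<lambda>f. g * D f | g. E g = 0}"

lemma fields_along_zero: "derivation D \<Longrightarrow> T \<in> fields_along D E \<Longrightarrow> T 0 = 0"
  by (auto simp: fields_along_def derivation_zero)

text \<open>
  \<open>[g D, h D] = (g D h - h D g) D\<close>, and \<open>E\<close> kills the new coefficient because it commutes with \<open>D\<close>.
\<close>

lemma commutator_along:
  assumes D: "derivation D" and E: "derivation E" and comm: "\<And>f. D (E f) = E (D f)"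
    and "S \<in> fields_along D E" "T \<in> fields_along D E"
  shows "commutator S T \<in> fields_along D E"
proof -
  obtain g h where S: "S = (\<lambda>f. g * D f)" "E g = 0" and T: "T = (\<lambda>f. h * D f)" "E h = 0"
    using assms(4,5) by (auto simp: fields_along_def)
  have "commutator S T = (\<lambda>f. (g * D h - h * D g) * D f)"
    by (simp add: commutator_def S(1) T(1) derivation_mult[OF D] algebra_simps)
  moreover have "E (D g) = 0" "E (D h) = 0"
    by (simp_all add: S(2) T(2) derivation_zero[OF D] flip: comm)
  then have "E (g * D h - h * D g) = 0"
    by (simp add: derivation_diff[OF E] derivation_mult[OF E] S(2) T(2))
  ultimately show ?thesis
    by (auto simp: fields_along_def)
qed

text \<open>
  In \<open>[g D, h E] = g (D h) E - h (E g) D + g h [D, E]\<close> each term is zero.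
\<close>

lemma commutator_transverse:
  assumes D: "derivation D" and E: "derivation E" and comm: "\<And>f. D (E f) = E (D f)"
    and "S \<in> fields_along D E" "T \<in> fields_along E D"
  shows "commutator S T = 0"
proof -
  obtain g h where S: "S = (\<lambda>f. g * D f)" "E g = 0" and T: "T = (\<lambda>f. h * E f)" "D h = 0"
    using assms(4,5) by (auto simp: fields_along_def)
  show ?thesis
    by (simp add: fun_eq_iff commutator_def S T derivation_mult[OF D] derivation_mult[OF E]
        comm algebra_simps)
qed

section \<open>Brackets of words\<close>

lemma word_bracket_snoc:
  "w \<noteq> [] \<Longrightarrow> word_bracket B (w @ [m]) = commutator (B m) (word_bracket B w)"
  by (cases w) simp_all

text \<open>
  The first two conclusions are what makes the induction on the last letter work: while only one kind
  of letter has occurred, the bracket must be known to be a field of that kind.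
\<close>

lemma word_bracket_two_kinds:
  assumes D: "derivation D" and E: "derivation E" and comm: "\<And>f. D (E f) = E (D f)"
    and H: "\<And>n. n \<in> H \<Longrightarrow> B n \<in> fields_along D E"
    and V: "\<And>n. n \<in> V \<Longrightarrow> B n \<in> fields_along E D"
    and "w \<noteq> []" "set w \<subseteq> H \<union> V"
  shows "(set w \<subseteq> H \<longrightarrow> word_bracket B w \<in> fields_along D E) \<and>
    (set w \<subseteq> V \<longrightarrow> word_bracket B w \<in> fields_along E D) \<and>
    (\<not> set w \<subseteq> H \<longrightarrow> \<not> set w \<subseteq> V \<longrightarrow> word_bracket B w = 0)"
  using assms(6,7)
proof (induction w rule: rev_nonempty_induct)
  case (single n)
  then show ?case using H V by auto
next
  case (snoc m w)
  have IH: "set w \<subseteq> H \<Longrightarrow> word_bracket B w \<in> fields_along D E"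
      "set w \<subseteq> V \<Longrightarrow> word_bracket B w \<in> fields_along E D"
      "\<not> set w \<subseteq> H \<Longrightarrow> \<not> set w \<subseteq> V \<Longrightarrow> word_bracket B w = 0"
    using snoc by auto
  have m: "m \<in> H \<or> m \<in> V" using snoc.prems by auto
  have "B m 0 = 0"
    using m H V fields_along_zero[OF D] fields_along_zero[OF E] by blast
  then have zero: "commutator (B m) 0 = 0"
    by (simp add: commutator_def fun_eq_iff)
  have HV: "commutator (B m) (word_bracket B w) = 0" if "m \<in> H" "set w \<subseteq> V"
    using commutator_transverse[OF D E comm] H that IH(2) by blast
  have VH: "commutator (B m) (word_bracket B w) = 0" if "m \<in> V" "set w \<subseteq> H"
    using commutator_transverse[OF E D comm[symmetric]] V that IH(1) by blast
  have HH: "commutator (B m) (word_bracket B w) \<in> fields_along D E" if "m \<in> H" "set w \<subseteq> H"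
    using commutator_along[OF D E comm] H that IH(1) by blast
  have VV: "commutator (B m) (word_bracket B w) \<in> fields_along E D" if "m \<in> V" "set w \<subseteq> V"
    using commutator_along[OF E D comm[symmetric]] V that IH(2) by blast
  have "commutator (B m) (word_bracket B w) = 0"
    if "\<not> set (w @ [m]) \<subseteq> H" "\<not> set (w @ [m]) \<subseteq> V"
  proof (cases "set w \<subseteq> H \<or> set w \<subseteq> V")
    case True
    then show ?thesis using that m HV VH by auto
  next
    case False
    then show ?thesis using IH(3) zero by simp
  qed
  then show ?case
    using HH VV by (simp add: word_bracket_snoc[OF snoc.hyps(1)])
qed

corollary word_bracket_mixed:
  assumes "derivation D" "derivation E" "\<And>f. D (E f) = E (D f)"
    and "\<And>n. n \<in> H \<Longrightarrow> B n \<in> fields_along D E"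
    and "\<And>n. n \<in> V \<Longrightarrow> B n \<in> fields_along E D"
    and "set w \<subseteq> H \<union> V" "\<not> set w \<subseteq> H" "\<not> set w \<subseteq> V"
  shows "word_bracket B w = 0"
  using word_bracket_two_kinds[of D E H B V w] assms by fastforce

section \<open>The partial derivatives as commuting derivations\<close>

lemma coeff_dx: "coeff (dx f) n = pderiv (coeff f n)"
  by (simp add: dx_def coeff_map_poly)

lemma pderiv_sum: "pderiv (\<Sum>i\<in>A. F i) = (\<Sum>i\<in>A. pderiv (F i))"
  by (induction A rule: infinite_finite_induct) (simp_all add: pderiv_add)

lemma derivation_dx: "derivation dx"
  unfolding derivation_def
proof (intro conjI allI)
  fix f g
  show "dx (f + g) = dx f + dx g"
    by (simp add: poly_eq_iff[of "dx (f + g)"] coeff_dx pderiv_add)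
  have "pderiv (u * v) = pderiv u * v + u * pderiv v" for u v :: "complex poly"
    by (simp add: pderiv_mult mult.commute)
  then show "dx (f * g) = dx f * g + f * dx g"
    by (intro poly_eqI) (simp add: coeff_dx coeff_mult pderiv_sum sum.distrib)
qed

lemma derivation_dy: "derivation dy"
  by (simp add: derivation_def dy_def pderiv_add pderiv_mult algebra_simps)

lemma dx_dy_commute: "dx (dy f) = dy (dx f)"
proof (rule poly_eqI)
  fix n
  have "pderiv (of_nat k * c) = of_nat k * pderiv c" for k and c :: "complex poly"
    by (simp add: of_nat_poly pderiv_smult)
  from this[of "Suc n"] show "coeff (dx (dy f)) n = coeff (dy (dx f)) n"
    by (simp add: coeff_dx dy_def coeff_pderiv del: of_nat_Suc)
qed

section \<open>Horizontal and vertical letters\<close>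

definition horizontal :: "(int \<times> int) set"
  where "horizontal = {(a, 0) | a. 0 < a}"

definition vertical :: "(int \<times> int) set"
  where "vertical = {(0, b) | b. 0 < b}"

lemma word_weight_eq: "word_weight \<xi> w = \<xi> * of_int (\<Sum>(a, b)\<leftarrow>w. a - b)"
  by (induction w) (auto simp: word_weight_def letter_weight_def algebra_simps)

lemma horizontal_sum_pos: "w \<noteq> [] \<Longrightarrow> set w \<subseteq> horizontal \<Longrightarrow> (\<Sum>(a, b)\<leftarrow>w. a - b) > 0"
  by (induction w rule: list_nonempty_induct) (auto simp: horizontal_def)

lemma vertical_sum_neg: "w \<noteq> [] \<Longrightarrow> set w \<subseteq> vertical \<Longrightarrow> (\<Sum>(a, b)\<leftarrow>w. a - b) < 0"
  by (induction w rule: list_nonempty_induct) (auto simp: vertical_def)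

lemma resonant_word_mixed:
  assumes "\<xi> \<noteq> 0" "w \<noteq> []" "word_weight \<xi> w = 0"
  shows "\<not> set w \<subseteq> horizontal" "\<not> set w \<subseteq> vertical"
  using assms horizontal_sum_pos[of w] vertical_sum_neg[of w]
  by (auto simp: word_weight_eq)

text \<open>
  From here on, \<open>p\<close> vanishes at all indices \<open>(i, j)\<close> with \<open>j \<ge> 1\<close> that occur in \<open>P\<close>. The letter
  \<open>(a, b)\<close> carries the coefficients \<open>p\<^sub>a\<^sub>+\<^sub>1\<^sub>,\<^sub>b\<close> and the conjugate of \<open>p\<^sub>b\<^sub>+\<^sub>1\<^sub>,\<^sub>a\<close>, so it can only occur
  when \<open>a\<close> or \<open>b\<close> is zero.
\<close>

context
  fixes d :: nat and p :: "nat \<Rightarrow> nat \<Rightarrow> complex"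
  assumes p_zero: "\<And>i j. 1 \<le> j \<Longrightarrow> 2 \<le> i + j \<Longrightarrow> i + j \<le> d \<Longrightarrow> p i j = 0"
begin

lemma coef_dx_eq_0: "b \<noteq> 0 \<Longrightarrow> coef_dx d p (a, b) = 0"
  by (auto simp: coef_dx_def p_zero)

lemma coef_dy_eq_0: "a \<noteq> 0 \<Longrightarrow> coef_dy d p (a, b) = 0"
  by (auto simp: coef_dy_def p_zero)

lemma degree_cases:
  assumes "n \<in> degrees d p"
  shows "n \<in> horizontal \<union> vertical"
proof -
  obtain a b where n: "n = (a, b)" by fastforce
  have "coef_dx d p n \<noteq> 0 \<or> coef_dy d p n \<noteq> 0"
    using assms by (auto simp: degrees_def hom_op_eq fun_eq_iff)
  then show ?thesis
  proof
    assume nz: "coef_dx d p n \<noteq> 0"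
    then have "b = 0" using coef_dx_eq_0 n by blast
    with nz show ?thesis by (auto simp: n coef_dx_def horizontal_def split: if_splits)
  next
    assume nz: "coef_dy d p n \<noteq> 0"
    then have "a = 0" using coef_dy_eq_0 n by blast
    with nz show ?thesis by (auto simp: n coef_dy_def vertical_def split: if_splits)
  qed
qed

lemma hom_op_horizontal:
  assumes "n \<in> horizontal"
  shows "hom_op d p n \<in> fields_along dx dy"
proof -
  obtain a where n: "n = (a, 0)" "0 < a" using assms by (auto simp: horizontal_def)
  then have "hom_op d p n = (\<lambda>f. coef_dx d p n * dx f)"
    by (simp add: hom_op_eq coef_dy_eq_0)
  moreover have "dy (coef_dx d p n) = 0"
    using n by (simp add: coef_dx_def dy_monom derivation_zero[OF derivation_dy])
  ultimately show ?thesis by (auto simp: fields_along_def)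
qed

lemma hom_op_vertical:
  assumes "n \<in> vertical"
  shows "hom_op d p n \<in> fields_along dy dx"
proof -
  obtain b where n: "n = (0, b)" "0 < b" using assms by (auto simp: vertical_def)
  then have "hom_op d p n = (\<lambda>f. coef_dy d p n * dy f)"
    by (simp add: hom_op_eq coef_dx_eq_0)
  moreover have "dx (coef_dy d p n) = 0"
    using n by (simp add: coef_dy_def dx_monom derivation_zero[OF derivation_dx])
  ultimately show ?thesis by (auto simp: fields_along_def)
qed

lemma resonant_word_bracket_eq_0:
  assumes "\<xi> \<noteq> 0" "w \<in> lists (degrees d p)" "w \<noteq> []" "word_weight \<xi> w = 0"
  shows "word_bracket (hom_op d p) w = 0"
proof (rule word_bracket_mixed[OF derivation_dx derivation_dy dx_dy_commute
      hom_op_horizontal hom_op_vertical])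
  show "set w \<subseteq> horizontal \<union> vertical" using assms(2) degree_cases by auto
qed (use resonant_word_mixed[OF assms(1,3,4)] in auto)

end

section \<open>Triviality of the resonant subset\<close>

lemma lie_generated_trivial:
  assumes "S \<subseteq> {0}"
  shows "lie_generated S = {0}"
proof -
  have "T = 0" if "T \<in> lie_generated S" for T
    using that
    by induction (use assms in \<open>auto simp: op_scale_def commutator_def fun_eq_iff\<close>)
  then show ?thesis using lie_generated.zero by blast
qed

theorem lemma5:
  fixes d :: nat and \<xi> :: complex and p :: "nat \<Rightarrow> nat \<Rightarrow> complex"
  assumes "d \<ge> 2"
    and "\<xi>\<^sup>2 = -1"
    and "\<forall>n\<in>{2..d}. \<forall>i\<in>{0..n - 1}. p i (n - i) = 0"
  shows "resonant_subset \<xi> d p = {0}"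
proof -
  have p_zero: "p i j = 0" if "1 \<le> j" "2 \<le> i + j" "i + j \<le> d" for i j
    using assms(3)[rule_format, of "i + j" i] that by simp
  have "\<xi> \<noteq> 0" using assms(2) by auto
  then have "word_bracket (hom_op d p) w = 0"
    if "w \<in> lists (degrees d p)" "w \<noteq> []" "word_weight \<xi> w = 0" for w
    using resonant_word_bracket_eq_0[of d p \<xi> w] p_zero that by blast
  then show ?thesis
    unfolding resonant_subset_def by (intro lie_generated_trivial) blast
qed

end
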